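(* Suppose that for the distribution function of a statistic $U$ we have $$F(x)\equiv\Pr\{U\le x\}=G(x)+\epsilon g(x)a(x)+R_2(x),$$ where $G$ is the limiting distribution function, with density function $g$, $a$ is a real function, and for the remainder term $R_2(x)$ there exists a constant $c_2$ such that $$|R_2(x)|\le d_2\equiv c_2\epsilon^2 .$$ Let $T=T(u)$ be a monotone increasing transform such that $$\Pr\{T(U)\le x\}=G(x)+\tilde R_2(x)\quad\text{with}\quad|\tilde R_2(x)|\le\tilde d_2\equiv\tilde c_2\epsilon^2,$$ where $\tilde c_2$ is a constant. Let $\tilde x_\alpha$ and $u_\alpha$ be the upper $100\alpha\%$ points of $\Pr\{T(U)\le x\}$ (as a distribution function of $x$) and $G$, respectively. Then for any $\alpha$ such that $$1-\tilde c_2\epsilon^2>\alpha>\tilde c_2\epsilon^2>0$$ we have $$|\tilde x_\alpha-u_\alpha|\le\tilde c_2\epsilon^2/g(u_{(2)}),$$ where $$g(u_{(2)})=\min_{u\in[u_{\alpha+\tilde d_2},\,u_{\alpha-\tilde d_2}]}g(u).$$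
   Context: $U$ is a real-valued random variable (a statistic). $\epsilon>0$ is a small parameter, typically $n^{-1/2}$ or $n^{-1}$ with $n$ the number of observations. For a distribution function $H$ and $\beta\in(0,1)$, the upper $100\beta\%$ point of $H$ is a number $x$ with $H(x)=1-\beta$; thus $\Pr\{T(U)\le\tilde x_\alpha\}=G(u_\alpha)=1-\alpha$, and $u_\beta$ denotes the upper $100\beta\%$ point of $G$ also for $\beta=\alpha\pm\tilde d_2$. Such a point is uniquely determined if $H$ is continuous and strictly increasing; in the general case the inverse of a distribution function is defined by $H^{-1}(v)=\inf\{x: H(x)>v\}$. *)

theory Defs
  imports "HOL-Probability.Probability"
begin

(* The integral of the nonnegative g over the real line being 1 is the prob_space conjunct. *)
definition distribution_function_with_density :: "(real \<Rightarrow> real) \<Rightarrow> (real \<Rightarrow> real) \<Rightarrow> bool" where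
  "distribution_function_with_density G g \<longleftrightarrow>
     g \<in> borel_measurable borel \<and> (\<forall>x. 0 \<le> g x) \<and>
     prob_space (density lborel (\<lambda>x. ennreal (g x))) \<and>
     G = cdf (density lborel (\<lambda>x. ennreal (g x)))"

(* A real Inf, hence meaningful for a distribution function H and 0 < v < 1 only. *)
definition df_inverse :: "(real \<Rightarrow> real) \<Rightarrow> real \<Rightarrow> real" where
  "df_inverse H v = Inf {x. H x > v}"

(* The point x with H x = 1 - \<beta> when that equation has exactly one solution
   (upper_point_eqI); in general the inverse H^{-1}(1 - \<beta>), which solves the
   equation whenever H is continuous (upper_point_solves). *)
definition upper_point :: "(real \<Rightarrow> real) \<Rightarrow> real \<Rightarrow> real" where
  "upper_point H \<beta> = df_inverse H (1 - \<beta>)"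

lemma upper_point_eqI:
  assumes "mono H" and x: "H x = 1 - \<beta>" and uniq: "\<And>y. H y = 1 - \<beta> \<Longrightarrow> y = x"
  shows "upper_point H \<beta> = x"
proof -
  have "{y. H y > 1 - \<beta>} = {x<..}"
  proof (intro set_eqI iffI)
    fix y assume "y \<in> {y. H y > 1 - \<beta>}"
    then have "H x < H y" using x by simp
    then show "y \<in> {x<..}" using monoD[OF \<open>mono H\<close>, of y x] by force
  next
    fix y assume "y \<in> {x<..}"
    then have "H x \<le> H y" "H y \<noteq> 1 - \<beta>"
      using monoD[OF \<open>mono H\<close>, of x y] uniq[of y] by auto
    then show "y \<in> {y. H y > 1 - \<beta>}" using x by simp
  qed
  then show ?thesis by (simp add: upper_point_def df_inverse_def)
qed

lemma upper_point_solves: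
  assumes "mono H" and cont: "continuous_on UNIV H"
    and below: "H a \<le> 1 - \<beta>" and above: "1 - \<beta> < H b"
  shows "H (upper_point H \<beta>) = 1 - \<beta>"
proof -
  let ?S = "{x. H x > 1 - \<beta>}"
  let ?s = "Inf ?S"
  have ne: "?S \<noteq> {}" using above by blast
  have bdd: "bdd_below ?S"
  proof (rule bdd_belowI)
    fix x assume "x \<in> ?S"
    then have "H a < H x" using below by simp
    then show "a \<le> x" using monoD[OF \<open>mono H\<close>, of x a] by force
  qed
  have opn: "open ?S" using cont by (intro open_Collect_less) auto
  have "?s \<notin> ?S"
  proof
    assume "?s \<in> ?S"
    then obtain e where e: "e > 0" "ball ?s e \<subseteq> ?S"
      using opn by (auto simp only: open_contains_ball)
    then have "?s - e / 2 \<in> ball ?s e" by (simp add: dist_real_def)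
    then have "?s - e / 2 \<in> ?S" using e(2) by (rule rev_subsetD)
    then have "?s \<le> ?s - e / 2" using bdd by (rule cInf_lower)
    then show False using e(1) by simp
  qed
  moreover have "?s \<in> closure ?S" by (rule closure_contains_Inf[OF ne bdd])
  moreover have "closure ?S \<subseteq> {x. H x \<ge> 1 - \<beta>}"
    using cont by (intro closure_minimal closed_Collect_le) auto
  ultimately have "H ?s = 1 - \<beta>" by auto
  then show ?thesis by (simp add: upper_point_def df_inverse_def)
qed

end

theory Submission
  imports Defs
begin

text \<open>Let \<open>H\<close> be the distribution function of \<open>T(U)\<close> and \<open>d\<close> the bound on its remainder. Since
  \<open>|H - G| \<le> d\<close>, the upper point of \<open>H\<close> at level \<open>\<alpha>\<close> lies between those of \<open>G\<close> at levels \<open>\<alpha> + d\<close> and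
  \<open>\<alpha> - d\<close>, where the continuous function \<open>G\<close> equals \<open>1 - \<alpha> - d\<close> and \<open>1 - \<alpha> + d\<close>. So the values of \<open>G\<close>
  at the two points to be compared differ by at most \<open>d\<close>, and by at least the distance of the points
  times the minimum of the density.\<close>

text \<open>An infimum can only drop when its set grows. As \<open>Inf\<close> on the reals says
  something only for nonempty sets bounded below, \<open>b\<close> witnesses that the smaller set is
  nonempty and \<open>a\<close> bounds the larger one.\<close>

lemma upper_point_le:
  assumes incl: "\<And>x. H x > 1 - \<beta> \<Longrightarrow> K x > 1 - \<gamma>"
    and above: "1 - \<beta> < H b"
    and below: "\<And>x. K x > 1 - \<gamma> \<Longrightarrow> a \<le> x"
  shows "upper_point K \<gamma> \<le> upper_point H \<beta>"
proof -
  have "bdd_below {x. K x > 1 - \<gamma>}"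
    using below by (intro bdd_belowI[of _ a]) auto
  then show ?thesis
    unfolding upper_point_def df_inverse_def
    using above incl by (intro cInf_superset_mono) auto
qed

text \<open>Shifting the level by \<open>d\<close> absorbs the error:
  \<open>H x > 1 - \<beta>\<close> forces \<open>G x > 1 - \<beta> - d\<close>, and
  \<open>G x > 1 - \<beta> + d\<close> forces \<open>H x > 1 - \<beta>\<close>. These inclusions
  order the infima.\<close>

lemma upper_point_close_bounds:
  assumes "mono G"
    and close: "\<And>x. \<bar>H x - G x\<bar> \<le> d"
    and below: "G a < 1 - \<beta> - d" and above: "1 - \<beta> + d < G b"
  shows "upper_point G (\<beta> + d) \<le> upper_point H \<beta>"
    and "upper_point H \<beta> \<le> upper_point G (\<beta> - d)"
proof -
  have *: "G x - d \<le> H x" "H x \<le> G x + d" for x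
    using close[of x] by auto
  have le: "a \<le> x" if "G a < G x" for x
    using that monoD[OF \<open>mono G\<close>, of x a] by force
  show "upper_point G (\<beta> + d) \<le> upper_point H \<beta>"
  proof (rule upper_point_le)
    show "1 - \<beta> < H b" using *(1)[of b] above by linarith
    show "1 - (\<beta> + d) < G x" if "1 - \<beta> < H x" for x using *(2)[of x] that by linarith
    show "a \<le> x" if "1 - (\<beta> + d) < G x" for x using le[of x] that below by linarith
  qed
  show "upper_point H \<beta> \<le> upper_point G (\<beta> - d)"
  proof (rule upper_point_le)
    show "1 - (\<beta> - d) < G b" using above by linarith
    show "1 - \<beta> < H x" if "1 - (\<beta> - d) < G x" for x using *(1)[of x] that by linarith
    show "a \<le> x" if "1 - \<beta> < H x" for x using le[of x] *(2)[of x] that below by linarith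
  qed
qed

context
  fixes G g :: "real \<Rightarrow> real"
  assumes density: "distribution_function_with_density G g"
begin

interpretation real_distribution "density lborel (\<lambda>x. ennreal (g x))"
  using density
  by (simp add: distribution_function_with_density_def real_distribution_def
      real_distribution_axioms_def)

lemma G_eq: "G = cdf (density lborel (\<lambda>x. ennreal (g x)))"
  using density by (simp add: distribution_function_with_density_def)

lemma g_measurable [measurable]: "g \<in> borel_measurable borel"
  using density by (simp add: distribution_function_with_density_def)

lemma density_distribution_mono: "mono G"
  unfolding G_eq by (rule monoI) (rule cdf_nondecreasing)

text \<open>A measure with a Lebesgue density has no atoms, and a distribution function jumps only
  at atoms.\<close>

lemma density_distribution_continuous: "continuous_on UNIV G"
proof -
  have "measure (density lborel (\<lambda>x. ennreal (g x))) {x} = 0" for x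
    by (simp add: measure_def emeasure_density nn_integral_indicator_singleton)
  then show ?thesis
    unfolding G_eq by (simp add: continuous_on_eq_continuous_at isCont_cdf)
qed

lemma density_distribution_ex_less:
  assumes "0 < v"
  shows "\<exists>x. G x < v"
  using order_tendstoD(2)[OF cdf_lim_at_bot assms]
  unfolding G_eq eventually_at_bot_linorder by blast

lemma density_distribution_ex_greater:
  assumes "v < 1"
  shows "\<exists>x. v < G x"
  using order_tendstoD(1)[OF cdf_lim_at_top_prob assms]
  unfolding G_eq eventually_at_top_linorder by blast

text \<open>Integrating the constant \<open>m\<close> below \<open>g\<close> over
  \<open>{x<..y}\<close> takes the place of the mean value theorem, since \<open>g\<close> is merely
  measurable.\<close>

lemma density_distribution_increment_ge:
  assumes "x \<le> y" and "0 \<le> m" and m: "\<And>t. t \<in> {x..y} \<Longrightarrow> m \<le> g t"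
  shows "m * (y - x) \<le> G y - G x"
proof (cases "x = y")
  case False
  let ?D = "density lborel (\<lambda>t. ennreal (g t))"
  have "ennreal (m * (y - x)) = (\<integral>\<^sup>+ t. ennreal m * indicator {x<..y} t \<partial>lborel)"
    using assms by (simp add: nn_integral_cmult ennreal_mult)
  also have "\<dots> \<le> (\<integral>\<^sup>+ t. ennreal (g t) * indicator {x<..y} t \<partial>lborel)"
    using m by (intro nn_integral_mono) (auto simp: indicator_def ennreal_leI)
  also have "\<dots> = emeasure ?D {x<..y}"
    by (simp add: emeasure_density)
  also have "\<dots> = ennreal (G y - G x)"
    using False \<open>x \<le> y\<close> by (simp add: emeasure_eq_measure G_eq cdf_diff_eq)
  finally show ?thesis
    using monoD[OF density_distribution_mono \<open>x \<le> y\<close>] by (simp add: ennreal_le_iff)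
qed simp

end

theorem theorem2:
  fixes M :: "'a measure" and U :: "'a \<Rightarrow> real"
    and G g a R\<^sub>2 T tR\<^sub>2 :: "real \<Rightarrow> real"
    and \<epsilon> c\<^sub>2 tc\<^sub>2 \<alpha> tx\<^sub>\<alpha> u\<^sub>\<alpha> u2 :: real
  assumes "prob_space M"
    and "U \<in> borel_measurable M"
    and "\<epsilon> > 0"
    and "distribution_function_with_density G g"
    and "\<And>x. \<P>(\<omega> in M. U \<omega> \<le> x) = G x + \<epsilon> * g x * a x + R\<^sub>2 x"
    and "\<And>x. \<bar>R\<^sub>2 x\<bar> \<le> c\<^sub>2 * \<epsilon>\<^sup>2"
    and "mono T"
    and "\<And>x. \<P>(\<omega> in M. T (U \<omega>) \<le> x) = G x + tR\<^sub>2 x"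
    and "\<And>x. \<bar>tR\<^sub>2 x\<bar> \<le> tc\<^sub>2 * \<epsilon>\<^sup>2"
    and "tx\<^sub>\<alpha> = upper_point (\<lambda>x. \<P>(\<omega> in M. T (U \<omega>) \<le> x)) \<alpha>"
    and "u\<^sub>\<alpha> = upper_point G \<alpha>"
    and "1 - tc\<^sub>2 * \<epsilon>\<^sup>2 > \<alpha>" and "\<alpha> > tc\<^sub>2 * \<epsilon>\<^sup>2" and "tc\<^sub>2 * \<epsilon>\<^sup>2 > 0"
    and "is_arg_min g (\<lambda>u. u \<in> {upper_point G (\<alpha> + tc\<^sub>2 * \<epsilon>\<^sup>2)..upper_point G (\<alpha> - tc\<^sub>2 * \<epsilon>\<^sup>2)}) u2"
  shows "ereal \<bar>tx\<^sub>\<alpha> - u\<^sub>\<alpha>\<bar> \<le> ereal (tc\<^sub>2 * \<epsilon>\<^sup>2) / ereal (g u2)"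
proof -
  define d where "d = tc\<^sub>2 * \<epsilon>\<^sup>2"
  define H where "H = (\<lambda>x. \<P>(\<omega> in M. T (U \<omega>) \<le> x))"
  note dens = assms(4)
  note mono = density_distribution_mono[OF dens]
  note solves = upper_point_solves[OF mono density_distribution_continuous[OF dens]]
  have d: "0 < d" "d < \<alpha>" "\<alpha> < 1 - d"
    using assms(12-14) by (simp_all add: d_def)
  \<comment> \<open>Both shifted levels lie strictly inside the unit interval, so the limits of
    \<open>G\<close> at both ends supply points \<open>p\<close> and \<open>q\<close> beyond
    them.\<close>
  have "0 < 1 - \<alpha> - d" and "1 - \<alpha> + d < 1"
    using d by simp_all
  then obtain p q where p: "G p < 1 - \<alpha> - d" and q: "1 - \<alpha> + d < G q"
    using density_distribution_ex_less[OF dens] density_distribution_ex_greater[OF dens] by meson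
  define l h where "l = upper_point G (\<alpha> + d)" and "h = upper_point G (\<alpha> - d)"
  have "\<bar>H x - G x\<bar> \<le> d" for x
    using assms(8,9)[of x] by (simp add: H_def d_def)
  from upper_point_close_bounds[OF mono this p q]
  have tx: "tx\<^sub>\<alpha> \<in> {l..h}"
    unfolding assms(10) H_def[symmetric] l_def h_def by simp
  \<comment> \<open>The same bounds with \<open>G\<close> in the role of \<open>H\<close> place
    \<open>u\<^sub>\<alpha>\<close> in the interval.\<close>
  have "\<bar>G x - G x\<bar> \<le> d" for x
    using d(1) by simp
  from upper_point_close_bounds[OF mono this p q]
  have u: "u\<^sub>\<alpha> \<in> {l..h}"
    unfolding assms(11) l_def h_def by simp
  \<comment> \<open>Only \<open>G\<close> is known to be continuous and so to attain its levels;
    \<open>H\<close> may jump. Hence \<open>G tx\<^sub>\<alpha>\<close> is confined by monotonicity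
    between \<open>G l\<close> and \<open>G h\<close>.\<close>
  have "G l = 1 - (\<alpha> + d)" "G h = 1 - (\<alpha> - d)" and "G u\<^sub>\<alpha> = 1 - \<alpha>"
    unfolding l_def h_def assms(11) using p q d(1) by (intro solves[of p _ q]; linarith)+
  then have Gtx: "\<bar>G tx\<^sub>\<alpha> - G u\<^sub>\<alpha>\<bar> \<le> d"
    using monoD[OF mono, of l "tx\<^sub>\<alpha>"] monoD[OF mono, of "tx\<^sub>\<alpha>" h] tx by auto
  have gmin: "g u2 \<le> g t" if "t \<in> {l..h}" for t
    using assms(15) that unfolding is_arg_min_linorder l_def h_def d_def by blast
  have g0: "0 \<le> g u2"
    using dens unfolding distribution_function_with_density_def by blast
  \<comment> \<open>The product form also covers a vanishing minimum; division comes
    afterwards.\<close>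
  have "g u2 * \<bar>tx\<^sub>\<alpha> - u\<^sub>\<alpha>\<bar> \<le> d"
  proof (cases "tx\<^sub>\<alpha> \<le> u\<^sub>\<alpha>")
    case True
    then have "g u2 * (u\<^sub>\<alpha> - tx\<^sub>\<alpha>) \<le> G u\<^sub>\<alpha> - G tx\<^sub>\<alpha>"
      using tx u by (intro density_distribution_increment_ge[OF dens] g0 gmin) auto
    then show ?thesis using True Gtx by simp
  next
    case False
    then have "g u2 * (tx\<^sub>\<alpha> - u\<^sub>\<alpha>) \<le> G tx\<^sub>\<alpha> - G u\<^sub>\<alpha>"
      using tx u by (intro density_distribution_increment_ge[OF dens] g0 gmin) auto
    then show ?thesis using False Gtx by simp
  qed
  then show ?thesis
  proof (cases "g u2 = 0")
    case True
    \<comment> \<open>In \<^typ>\<open>ereal\<close>, a positive number divided by 0 is \<open>\<infinity>\<close>.\<close>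
    then show ?thesis using d(1) by (auto simp: d_def divide_ereal_def)
  next
    case False
    with \<open>g u2 * \<bar>tx\<^sub>\<alpha> - u\<^sub>\<alpha>\<bar> \<le> d\<close> g0 show ?thesis
      by (simp add: d_def pos_le_divide_eq mult.commute)
  qed
qed

end
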